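(* Let $\gamma=(x,z):(I,t_0)\to(\mathbb{R}^2,0)$ and $\widetilde\gamma=(\widetilde x,\widetilde z):(\widetilde I,\widetilde t_0)\to(\mathbb{R}^2,0)$ be smooth curves, let $\theta_0\in[0,2\pi)$, and let $\boldsymbol{z}:(I\times[0,2\pi),(t_0,\theta_0))\to(\mathbb{R}^3,0)$ and $\widetilde{\boldsymbol{z}}:(\widetilde I\times[0,2\pi),(\widetilde t_0,\theta_0))\to(\mathbb{R}^3,0)$ be the surfaces of revolution of $\gamma$ and $\widetilde\gamma$ around the $z$-axis, respectively. (1) If there exist diffeomorphism germs $\phi:(I,t_0)\to(\widetilde I,\widetilde t_0)$ and $\psi:(\mathbb{R}^2,0)\to(\mathbb{R}^2,0)$ of the form $\psi(X,Z)=(X,\varphi(X^2,Z))$ such that $\psi\circ\gamma=\widetilde\gamma\circ\phi$, then there exist diffeomorphism germs $\Phi:(I\times[0,2\pi),(t_0,\theta_0))\to(\widetilde I\times[0,2\pi),(\widetilde t_0,\theta_0))$ of the form $\Phi(t,\theta)=(\phi(t),\theta)$ and $\Psi:(\mathbb{R}^3,0)\to(\mathbb{R}^3,0)$ of the form $\Psi(X,Y,Z)=(X,Y,\varphi(X^2+Y^2,Z))$ such that $\Psi\circ\boldsymbol{z}=\widetilde{\boldsymbol{z}}\circ\Phi$. (2) If there exist diffeomorphism germs $\Phi:(I\times[0,2\pi),(t_0,\theta_0))\to(\widetilde I\times[0,2\pi),(\widetilde t_0,\theta_0))$ of the form $\Phi(t,\theta)=(\phi(t),\theta)$ and $\Psi:(\mathbb{R}^3,0)\to(\mathbb{R}^3,0)$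 of the form $\Psi(X,Y,Z)=(X,Y,\varphi(X^2+Y^2,Z))$ such that $\Psi\circ\boldsymbol{z}=\widetilde{\boldsymbol{z}}\circ\Phi$, then there exists a diffeomorphism germ $\psi:(\mathbb{R}^2,0)\to(\mathbb{R}^2,0)$ of the form $\psi(X,Z)=(X,\varphi(X^2,Z))$ such that $\psi\circ\gamma=\widetilde\gamma\circ\phi$.
   Context: All maps are $C^\infty$ and are considered as germs at the indicated points; $\varphi:(\mathbb{R}^2,0)\to(\mathbb{R},0)$ denotes a smooth function germ. The surface of revolution of $\gamma=(x,z)$ around the $z$-axis is $\boldsymbol{z}(t,\theta)=(x(t)\cos\theta,x(t)\sin\theta,z(t))$, and similarly for $\widetilde\gamma$. Germs at $\theta_0$ are taken with $\theta$ ranging over a neighbourhood of $\theta_0$ in $\mathbb{R}$ (the formulas are $2\pi$-periodic in $\theta$). *)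

theory Defs
  imports "HOL-Analysis.Analysis"
begin

text \<open>\<open>k_differentiable_on k S f\<close>: on the open set \<open>S\<close>, \<open>f\<close> is of class \<open>C\<^sup>k\<close>.
  The (k+1)-st stage asks that \<open>f\<close> be Frechet differentiable and that each directional
  derivative, again a function \<open>'a \<Rightarrow> 'b\<close>, be of class \<open>C\<^sup>k\<close>; quantifying over directions
  avoids the change of codomain of the total derivative.\<close>

primrec k_differentiable_on ::
  "nat \<Rightarrow> 'a::euclidean_space set \<Rightarrow> ('a \<Rightarrow> 'b::euclidean_space) \<Rightarrow> bool" where
  "k_differentiable_on 0 S f \<longleftrightarrow> continuous_on S f"
| "k_differentiable_on (Suc k) S f \<longleftrightarrow>
     (\<forall>x\<in>S. f differentiable (at x)) \<and>
     (\<forall>v. k_differentiable_on k S (\<lambda>x. frechet_derivative f (at x) v))"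

definition smooth_on :: "'a::euclidean_space set \<Rightarrow> ('a \<Rightarrow> 'b::euclidean_space) \<Rightarrow> bool" where
  "smooth_on S f \<longleftrightarrow> (\<forall>k. k_differentiable_on k S f)"

text \<open>Germs are represented by total functions whose values away from the base point are
  irrelevant. Accordingly, equality of germs at \<open>a\<close> is equality eventually in \<open>nhds a\<close>, and
  \<open>smooth_germ S a T b f\<close> and \<open>diffeo_germ S a T b f\<close> say that some restriction of \<open>f\<close>
  to an open neighbourhood of \<open>a\<close> represents a smooth map germ, respectively a
  diffeomorphism germ, \<open>(S, a) \<rightarrow> (T, b)\<close>.\<close>

definition germ_eq :: "'a::topological_space \<Rightarrow> ('a \<Rightarrow> 'b) \<Rightarrow> ('a \<Rightarrow> 'b) \<Rightarrow> bool" where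
  "germ_eq a f g \<longleftrightarrow> (\<forall>\<^sub>F x in nhds a. f x = g x)"

definition smooth_germ ::
  "'a::euclidean_space set \<Rightarrow> 'a \<Rightarrow> 'b::euclidean_space set \<Rightarrow> 'b \<Rightarrow> ('a \<Rightarrow> 'b) \<Rightarrow> bool" where
  "smooth_germ S a T b f \<longleftrightarrow>
     f a = b \<and> (\<exists>U. open U \<and> a \<in> U \<and> U \<subseteq> S \<and> f ` U \<subseteq> T \<and> smooth_on U f)"

definition diffeo_germ ::
  "'a::euclidean_space set \<Rightarrow> 'a \<Rightarrow> 'b::euclidean_space set \<Rightarrow> 'b \<Rightarrow> ('a \<Rightarrow> 'b) \<Rightarrow> bool" where
  "diffeo_germ S a T b f \<longleftrightarrow>
     f a = b \<and>
     (\<exists>U V g. open U \<and> a \<in> U \<and> U \<subseteq> S \<and> open V \<and> b \<in> V \<and> V \<subseteq> T \<and>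
        homeomorphism U V f g \<and> smooth_on U f \<and> smooth_on V g)"

definition surface_of_revolution ::
  "(real \<Rightarrow> real \<times> real) \<Rightarrow> real \<times> real \<Rightarrow> real \<times> real \<times> real" where
  "surface_of_revolution \<gamma> = (\<lambda>(t, \<theta>).
     (fst (\<gamma> t) * cos \<theta>, fst (\<gamma> t) * sin \<theta>, snd (\<gamma> t)))"

end

theory Submission
  imports Defs
begin

text \<open>
  Both \<open>\<psi>(X, Z) = (X, \<rho>(X\<^sup>2, Z))\<close> and \<open>\<Psi>(X, Y, Z) = (X, Y, \<rho>(X\<^sup>2 + Y\<^sup>2, Z))\<close> move points only along
  the \<open>Z\<close>-axis, by an amount that depends on \<open>Z\<close> and on a smooth function \<open>q\<close> of the remaining
  coordinates which vanishes at the origin. Maps of this kind, called fibre maps below, are diffeomorphism germs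
  if and only if the partial derivative \<open>\<rho>\<^sub>Z(0, 0)\<close> does not vanish, whatever \<open>q\<close> is. As this
  condition is the same for \<open>\<psi>\<close> and for \<open>\<Psi>\<close>, one of them is a diffeomorphism germ exactly when the
  other is.

  Sufficiency (\<open>fibre_map_diffeo\<close>): the inverse function theorem inverts \<open>\<rho>\<close> in its second variable
  on a full neighbourhood of the origin of the \<open>(u, Z)\<close>-plane (\<open>fibrewise_local_inverse\<close>). If
  \<open>\<sigma>\<close> is this fibrewise inverse, the fibre map of \<open>\<sigma>\<close> inverts the fibre map of \<open>\<rho>\<close>. The
  inverse of the given \<open>\<psi>\<close> determines \<open>\<sigma>\<close> only on the half-plane \<open>u \<ge> 0\<close>, because \<open>u = X\<^sup>2\<close>, and does not
  readily show smoothness of \<open>\<sigma>\<close> up to \<open>u = 0\<close>; this is why the argument goes through \<open>\<rho>\<^sub>Z(0, 0)\<close>.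

  Necessity (\<open>fibre_map_diffeo_imp_derivative_nonzero\<close>): along the \<open>Z\<close>-axis the map
  is \<open>s \<mapsto> \<rho>(0, s)\<close>, which has a differentiable left inverse.

  The two commutation relations are equivalent pointwise
  (\<open>surface_of_revolution_commutes_iff\<close>), because \<open>(x cos \<theta>)\<^sup>2 + (x sin \<theta>)\<^sup>2 = x\<^sup>2\<close>, and because
  \<open>x (cos \<theta>, sin \<theta>)\<close> determines \<open>x\<close> once \<open>\<theta>\<close> is fixed. It then remains to pass from \<open>t\<close> near \<open>t\<^sub>0\<close> to
  \<open>(t, \<theta>)\<close> near \<open>(t\<^sub>0, \<theta>\<^sub>0)\<close> by projection, and back along the slice \<open>\<theta> = \<theta>\<^sub>0\<close>.
\<close>

section \<open>Calculus of \<open>C\<^sup>k\<close> functions\<close>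

lemma k_differentiable_on_cong:
  assumes "open S" "\<And>x. x \<in> S \<Longrightarrow> f x = g x" "k_differentiable_on k S f"
  shows "k_differentiable_on k S g"
  using assms(2,3)
proof (induction k arbitrary: f g)
  case 0
  then show ?case using continuous_on_eq by fastforce
next
  case (Suc k)
  have diff: "f differentiable (at x)" if "x \<in> S" for x
    using Suc.prems that by simp
  have "g differentiable (at x)" if "x \<in> S" for x
    using diff[OF that] has_derivative_transform_within_open[OF _ assms(1) that] Suc.prems(1)
    unfolding differentiable_def by blast
  moreover have "k_differentiable_on k S (\<lambda>x. frechet_derivative g (at x) v)" for v
  proof (rule Suc.IH)
    show "k_differentiable_on k S (\<lambda>x. frechet_derivative f (at x) v)"
      using Suc.prems by simp
    show "frechet_derivative f (at x) v = frechet_derivative g (at x) v" if "x \<in> S" for x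
      using frechet_derivative_transform_within_open[OF diff[OF that] assms(1) that Suc.prems(1)]
      by simp
  qed
  ultimately show ?case by simp
qed

text \<open>This introduction rule replaces the Frechet derivative, a choice term, by an explicit
  formula \<open>D\<close> for the derivative, as supplied by the differentiation rules.\<close>

lemma k_differentiable_on_SucI:
  assumes "open S" "\<And>x. x \<in> S \<Longrightarrow> (f has_derivative D x) (at x)"
    and "\<And>v. k_differentiable_on k S (\<lambda>x. D x v)"
  shows "k_differentiable_on (Suc k) S f"
proof -
  have "k_differentiable_on k S (\<lambda>x. frechet_derivative f (at x) v)" for v
  proof (rule k_differentiable_on_cong[OF assms(1) _ assms(3)])
    show "D x v = frechet_derivative f (at x) v" if "x \<in> S" for x
      using frechet_derivative_at[OF assms(2)[OF that]] by simp
  qed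
  then show ?thesis
    using assms(2) by (auto simp: differentiable_def)
qed

lemma k_differentiable_on_SucD:
  assumes "k_differentiable_on (Suc k) S f"
  shows "x \<in> S \<Longrightarrow> (f has_derivative frechet_derivative f (at x)) (at x)"
    and "k_differentiable_on k S (\<lambda>x. frechet_derivative f (at x) v)"
  using assms by (auto simp: frechet_derivative_works)

lemma k_differentiable_on_decrease:
  "k_differentiable_on (Suc k) S f \<Longrightarrow> k_differentiable_on k S f"
proof (induction k arbitrary: f)
  case 0
  then show ?case
    by (auto intro!: continuous_at_imp_continuous_on differentiable_imp_continuous_within)
next
  case (Suc k)
  have "f differentiable (at x)" if "x \<in> S" for x
    using Suc.prems that by simp
  moreover have "k_differentiable_on k S (\<lambda>x. frechet_derivative f (at x) v)" for v
    by (rule Suc.IH[OF k_differentiable_on_SucD(2)[OF Suc.prems]])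
  ultimately show ?case by simp
qed

lemma k_differentiable_on_subset:
  "k_differentiable_on k S f \<Longrightarrow> T \<subseteq> S \<Longrightarrow> k_differentiable_on k T f"
proof (induction k arbitrary: f)
  case 0
  then show ?case using continuous_on_subset by auto
next
  case (Suc k)
  then show ?case by (simp add: subset_iff)
qed

lemma k_differentiable_on_const: "k_differentiable_on k S (\<lambda>x. c)"
  by (induction k arbitrary: c) simp_all

lemma k_differentiable_on_linear:
  assumes "open S" "bounded_linear f"
  shows "k_differentiable_on k S f"
proof (cases k)
  case 0
  then show ?thesis using assms(2) by (simp add: linear_continuous_on)
next
  case (Suc n)
  then show ?thesis
    using k_differentiable_on_SucI[OF assms(1) bounded_linear_imp_has_derivative[OF assms(2)]
        k_differentiable_on_const] by simp
qed

lemma k_differentiable_on_add: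
  assumes "open S" "k_differentiable_on k S f" "k_differentiable_on k S g"
  shows "k_differentiable_on k S (\<lambda>x. f x + g x)"
  using assms(2,3)
proof (induction k arbitrary: f g)
  case 0
  then show ?case by (auto intro: continuous_on_add)
next
  case (Suc k)
  show ?case
  proof (rule k_differentiable_on_SucI[OF assms(1)])
    show "((\<lambda>x. f x + g x) has_derivative
        (\<lambda>v. frechet_derivative f (at x) v + frechet_derivative g (at x) v)) (at x)" if "x \<in> S" for x
      by (intro has_derivative_add Suc.prems[THEN k_differentiable_on_SucD(1)] that)
    show "k_differentiable_on k S
        (\<lambda>x. frechet_derivative f (at x) v + frechet_derivative g (at x) v)" for v
      by (rule Suc.IH; rule k_differentiable_on_SucD(2); rule Suc.prems)
  qed
qed

lemma k_differentiable_on_sum: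
  assumes "open S" "finite B" "\<And>b. b \<in> B \<Longrightarrow> k_differentiable_on k S (f b)"
  shows "k_differentiable_on k S (\<lambda>x. \<Sum>b\<in>B. f b x)"
  using assms(2,3)
  by (induction B rule: finite_induct)
    (auto intro: k_differentiable_on_const k_differentiable_on_add[OF assms(1)])

lemma k_differentiable_on_bilinear:
  assumes "open S" "bounded_bilinear bl" "k_differentiable_on k S f" "k_differentiable_on k S g"
  shows "k_differentiable_on k S (\<lambda>x. bl (f x) (g x))"
  using assms(3,4)
proof (induction k arbitrary: f g)
  case 0
  then show ?case using bounded_bilinear.continuous_on[OF assms(2)] by auto
next
  case (Suc k)
  show ?case
  proof (rule k_differentiable_on_SucI[OF assms(1)])
    show "((\<lambda>x. bl (f x) (g x)) has_derivative
        (\<lambda>v. bl (f x) (frechet_derivative g (at x) v) + bl (frechet_derivative f (at x) v) (g x))) (at x)"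
      if "x \<in> S" for x
      by (intro bounded_bilinear.FDERIV[OF assms(2)] Suc.prems[THEN k_differentiable_on_SucD(1)] that)
    show "k_differentiable_on k S (\<lambda>x. bl (f x) (frechet_derivative g (at x) v)
        + bl (frechet_derivative f (at x) v) (g x))" for v
      by (intro k_differentiable_on_add[OF assms(1)] Suc.IH
          Suc.prems[THEN k_differentiable_on_decrease] Suc.prems[THEN k_differentiable_on_SucD(2)])
  qed
qed

text \<open>The chain rule produces the derivative of \<open>f\<close> in the direction \<open>Dg(x) v\<close>, which varies with
  \<open>x\<close>, whereas the class \<open>C\<^sup>k\<close> only speaks about fixed directions. Expanding this direction in
  the standard basis expresses the derivative of the composition by sums and products of functions
  to which the induction hypothesis applies.\<close>

lemma k_differentiable_on_compose:
  fixes f :: "'b::euclidean_space \<Rightarrow> 'c::euclidean_space"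
    and g :: "'a::euclidean_space \<Rightarrow> 'b"
  assumes "open S" "k_differentiable_on k T f" "k_differentiable_on k S g" "g ` S \<subseteq> T"
  shows "k_differentiable_on k S (\<lambda>x. f (g x))"
  using assms(2,3)
proof (induction k arbitrary: f)
  case 0
  then show ?case using assms(4) continuous_on_compose2 by fastforce
next
  case (Suc k)
  let ?D = "\<lambda>x v. \<Sum>b\<in>Basis. (frechet_derivative g (at x) v \<bullet> b) *\<^sub>R frechet_derivative f (at (g x)) b"
  show ?case
  proof (rule k_differentiable_on_SucI[OF assms(1)])
    fix x assume x: "x \<in> S"
    then have gx: "g x \<in> T" using assms(4) by auto
    have lin: "linear (frechet_derivative f (at (g x)))"
      using Suc.prems(1) gx linear_frechet_derivative by auto
    have "frechet_derivative f (at (g x)) w = (\<Sum>b\<in>Basis. (w \<bullet> b) *\<^sub>R frechet_derivative f (at (g x)) b)" for w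
    proof -
      have "frechet_derivative f (at (g x)) w
        = frechet_derivative f (at (g x)) (\<Sum>b\<in>Basis. (w \<bullet> b) *\<^sub>R b)"
        by (simp add: euclidean_representation)
      also have "\<dots> = (\<Sum>b\<in>Basis. (w \<bullet> b) *\<^sub>R frechet_derivative f (at (g x)) b)"
        by (simp add: linear_sum[OF lin] linear_cmul[OF lin])
      finally show ?thesis .
    qed
    then have "?D x = (\<lambda>v. frechet_derivative f (at (g x)) (frechet_derivative g (at x) v))"
      by (intro ext) (rule sym)
    moreover have "((\<lambda>x. f (g x)) has_derivative
        (\<lambda>v. frechet_derivative f (at (g x)) (frechet_derivative g (at x) v))) (at x)"
      by (rule has_derivative_compose[OF k_differentiable_on_SucD(1)[OF Suc.prems(2) x]
            k_differentiable_on_SucD(1)[OF Suc.prems(1) gx]])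
    ultimately show "((\<lambda>x. f (g x)) has_derivative ?D x) (at x)" by simp
  next
    fix v
    show "k_differentiable_on k S (\<lambda>x. ?D x v)"
    proof (rule k_differentiable_on_sum[OF assms(1) finite_Basis],
        rule k_differentiable_on_bilinear[OF assms(1) bounded_bilinear_scaleR])
      fix b :: 'b
      show "k_differentiable_on k S (\<lambda>x. frechet_derivative f (at (g x)) b)"
        using Suc k_differentiable_on_SucD(2) k_differentiable_on_decrease by blast
      show "k_differentiable_on k S (\<lambda>x. frechet_derivative g (at x) v \<bullet> b)"
        by (rule k_differentiable_on_bilinear[OF assms(1) bounded_bilinear_inner
              k_differentiable_on_SucD(2)[OF Suc.prems(2)] k_differentiable_on_const])
    qed
  qed
qed

lemma k_differentiable_on_linear_compose:
  assumes "open S" "bounded_linear h" "k_differentiable_on k S f"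
  shows "k_differentiable_on k S (\<lambda>x. h (f x))"
  by (rule k_differentiable_on_compose[OF assms(1) k_differentiable_on_linear[OF open_UNIV assms(2)] assms(3)])
     simp

lemma k_differentiable_on_Pair:
  fixes f :: "'a::euclidean_space \<Rightarrow> 'b::euclidean_space" and g :: "'a \<Rightarrow> 'c::euclidean_space"
  assumes "open S" "k_differentiable_on k S f" "k_differentiable_on k S g"
  shows "k_differentiable_on k S (\<lambda>x. (f x, g x))"
proof -
  have "bounded_linear (\<lambda>y::'b. (y, 0::'c))" "bounded_linear (\<lambda>y::'c. (0::'b, y))"
    by (auto intro!: bounded_linear_Pair bounded_linear_ident bounded_linear_zero)
  then have "k_differentiable_on k S (\<lambda>x. (f x, 0) + (0, g x))"
    using assms by (intro k_differentiable_on_add) (auto intro: k_differentiable_on_linear_compose)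
  then show ?thesis by simp
qed

lemma k_differentiable_on_inverse:
  fixes f :: "'a::euclidean_space \<Rightarrow> real"
  assumes "open S" "\<And>x. x \<in> S \<Longrightarrow> f x \<noteq> 0" "k_differentiable_on k S f"
  shows "k_differentiable_on k S (\<lambda>x. inverse (f x))"
  using assms(3)
proof (induction k)
  case 0
  then show ?case using assms(2) by (auto intro: continuous_on_inverse)
next
  case (Suc k)
  have IH: "k_differentiable_on k S (\<lambda>x. inverse (f x))"
    using Suc k_differentiable_on_decrease by blast
  show ?case
  proof (rule k_differentiable_on_SucI[OF assms(1)])
    show "((\<lambda>x. inverse (f x)) has_derivative
        (\<lambda>v. - (inverse (f x) * frechet_derivative f (at x) v * inverse (f x)))) (at x)" if "x \<in> S" for x
      using k_differentiable_on_SucD(1)[OF Suc.prems that] assms(2)[OF that]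
      by (rule Deriv.has_derivative_inverse[rotated])
    show "k_differentiable_on k S
        (\<lambda>x. - (inverse (f x) * frechet_derivative f (at x) v * inverse (f x)))" for v
      by (intro k_differentiable_on_linear_compose[OF assms(1) bounded_linear_minus[OF bounded_linear_ident]]
          k_differentiable_on_bilinear[OF assms(1) bounded_bilinear_mult] IH
          k_differentiable_on_SucD(2)[OF Suc.prems])
  qed
qed

lemma smooth_on_imp_continuous_on: "smooth_on S f \<Longrightarrow> continuous_on S f"
  unfolding smooth_on_def by (metis k_differentiable_on.simps(1))

lemma smooth_on_has_derivative:
  "smooth_on S f \<Longrightarrow> x \<in> S \<Longrightarrow> (f has_derivative frechet_derivative f (at x)) (at x)"
  unfolding smooth_on_def using k_differentiable_on_SucD(1) by blast

lemma smooth_on_frechet_derivative: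
  "smooth_on S f \<Longrightarrow> smooth_on S (\<lambda>x. frechet_derivative f (at x) v)"
  unfolding smooth_on_def using k_differentiable_on_SucD(2) by blast

lemma smooth_on_subset: "smooth_on S f \<Longrightarrow> T \<subseteq> S \<Longrightarrow> smooth_on T f"
  unfolding smooth_on_def using k_differentiable_on_subset by blast

lemma smooth_on_linear: "open S \<Longrightarrow> bounded_linear f \<Longrightarrow> smooth_on S f"
  unfolding smooth_on_def using k_differentiable_on_linear by blast

lemma smooth_on_const: "smooth_on S (\<lambda>x. c)"
  unfolding smooth_on_def using k_differentiable_on_const by blast

lemma smooth_on_add:
  "open S \<Longrightarrow> smooth_on S f \<Longrightarrow> smooth_on S g \<Longrightarrow> smooth_on S (\<lambda>x. f x + g x)"
  unfolding smooth_on_def using k_differentiable_on_add by blast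

lemma smooth_on_bilinear:
  "open S \<Longrightarrow> bounded_bilinear bl \<Longrightarrow> smooth_on S f \<Longrightarrow> smooth_on S g
    \<Longrightarrow> smooth_on S (\<lambda>x. bl (f x) (g x))"
  unfolding smooth_on_def using k_differentiable_on_bilinear by blast

lemma smooth_on_compose:
  "open S \<Longrightarrow> smooth_on T f \<Longrightarrow> smooth_on S g \<Longrightarrow> g ` S \<subseteq> T \<Longrightarrow> smooth_on S (\<lambda>x. f (g x))"
  unfolding smooth_on_def using k_differentiable_on_compose by blast

lemma smooth_on_Pair:
  "open S \<Longrightarrow> smooth_on S f \<Longrightarrow> smooth_on S g \<Longrightarrow> smooth_on S (\<lambda>x. (f x, g x))"
  unfolding smooth_on_def using k_differentiable_on_Pair by blast

section \<open>Inverting a function of two variables in its second variable\<close>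

lemma frechet_derivative_real_Pair:
  fixes f :: "real \<times> real \<Rightarrow> real"
  assumes "f differentiable (at p)"
  shows "frechet_derivative f (at p) (a, b) =
    a * frechet_derivative f (at p) (1, 0) + b * frechet_derivative f (at p) (0, 1)"
proof -
  note lin = linear_frechet_derivative[OF assms]
  have ab: "(a, b) = a *\<^sub>R (1, 0) + b *\<^sub>R (0, 1 :: real)" by simp
  show ?thesis
    by (simp only: ab linear_add[OF lin] linear_cmul[OF lin] real_scaleR_def)
qed

text \<open>The inverse function theorem applies to \<open>f(u, Z) = (u, \<rho>(u, Z))\<close>, whose Jacobian matrix
  is triangular with diagonal \<open>1, \<rho>\<^sub>Z\<close>. It gives a local inverse \<open>g\<close> that is merely differentiable.
  Solving the triangular system expresses the derivative of \<open>g\<close> by the partial derivatives of \<open>\<rho>\<close>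
  at the point \<open>g(y)\<close>, so that \<open>g\<close> is of class \<open>C\<^sup>k\<^sup>+\<^sup>1\<close> as soon as it is of class \<open>C\<^sup>k\<close>. The
  conclusion mentions only the second component \<open>\<sigma>\<close> of \<open>g\<close>, since the first one is \<open>u\<close>.\<close>

lemma fibrewise_local_inverse:
  fixes \<rho> :: "real \<times> real \<Rightarrow> real"
  assumes "open U" "0 \<in> U" and sm: "smooth_on U \<rho>" and "\<rho> 0 = 0"
    and nz: "frechet_derivative \<rho> (at 0) (0, 1) \<noteq> 0"
  obtains U' V \<sigma> where "open U'" "0 \<in> U'" "U' \<subseteq> U" "open V" "0 \<in> V" "smooth_on V \<sigma>"
    "\<And>u Z. (u, Z) \<in> U' \<Longrightarrow> (u, \<rho> (u, Z)) \<in> V \<and> \<sigma> (u, \<rho> (u, Z)) = Z"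
    "\<And>u W. (u, W) \<in> V \<Longrightarrow> (u, \<sigma> (u, W)) \<in> U' \<and> \<rho> (u, \<sigma> (u, W)) = W"
proof -
  define A where "A p = frechet_derivative \<rho> (at p) (1, 0)" for p
  define B where "B p = frechet_derivative \<rho> (at p) (0, 1)" for p
  have smA: "smooth_on U A" and smB: "smooth_on U B"
    unfolding A_def B_def by (rule smooth_on_frechet_derivative[OF sm])+
  have derR: "(\<rho> has_derivative (\<lambda>v. fst v * A p + snd v * B p)) (at p)" if "p \<in> U" for p
  proof -
    have h: "(\<rho> has_derivative frechet_derivative \<rho> (at p)) (at p)"
      by (rule smooth_on_has_derivative[OF sm that])
    have "frechet_derivative \<rho> (at p) = (\<lambda>v. fst v * A p + snd v * B p)"
      using frechet_derivative_real_Pair[of \<rho> p] h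
      by (auto simp: A_def B_def differentiable_def fun_eq_iff)
    then show ?thesis using h by simp
  qed
  \<comment> \<open>\<open>f\<close> is inverted inside the region where \<open>\<rho>\<^sub>Z\<close> does not vanish, so that the formula for the
    derivative of \<open>g\<close> is valid throughout \<open>V\<close>.\<close>
  define U1 where "U1 = U \<inter> B -` (- {0})"
  have "open U1"
    unfolding U1_def
    by (rule continuous_open_preimage[OF smooth_on_imp_continuous_on[OF smB] assms(1)]) auto
  have "0 \<in> U1" using assms(2) nz by (simp add: U1_def B_def)
  define f where "f p = (fst p, \<rho> p)" for p
  define D where "D p = (\<lambda>v::real \<times> real. (fst v, fst v * A p + snd v * B p))" for p
  have blD: "bounded_linear (D p)" for p
    unfolding D_def
    by (intro bounded_linear_Pair bounded_linear_add bounded_linear_fst bounded_linear_snd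
        bounded_linear_mult_const)
  define f' where "f' p = Blinfun (D p)" for p
  have f'app: "blinfun_apply (f' p) = D p" for p
    by (simp add: f'_def bounded_linear_Blinfun_apply[OF blD])
  have derf: "(f has_derivative blinfun_apply (f' p)) (at p)" if "p \<in> U1" for p
    unfolding f_def f'app D_def
    using derR[of p] that by (intro has_derivative_Pair) (auto simp: U1_def intro!: derivative_intros)
  have contAB: "continuous_on U1 A" "continuous_on U1 B"
    using smooth_on_imp_continuous_on[OF smA] smooth_on_imp_continuous_on[OF smB]
    by (auto simp: U1_def intro: continuous_on_subset)
  have contf: "continuous_on U1 f'"
    by (rule continuous_on_blinfun_componentwise)
      (auto simp: f'app D_def intro!: continuous_intros contAB)
  \<comment> \<open>The inverse of the triangular matrix \<open>D 0\<close>.\<close>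
  define J where "J = (\<lambda>v::real \<times> real. (fst v, (snd v - fst v * A 0) * inverse (B 0)))"
  have blJ: "bounded_linear J"
    unfolding J_def
    by (intro bounded_linear_Pair bounded_linear_sub bounded_linear_fst bounded_linear_snd
        bounded_linear_mult_const)
  have "B 0 \<noteq> 0" using nz by (simp add: B_def)
  then have invf: "Blinfun J o\<^sub>L f' 0 = id_blinfun"
    by (intro blinfun_eqI)
      (simp add: f'app bounded_linear_Blinfun_apply[OF blJ], simp add: J_def D_def mult.assoc prod_eq_iff)
  obtain U' V g g' where U': "open U'" "U' \<subseteq> U1" "0 \<in> U'" and V: "open V" "f 0 \<in> V"
    and hom: "homeomorphism U' V f g"
    and derg: "\<And>y. y \<in> V \<Longrightarrow> (g has_derivative g' y) (at y)"
    and g': "\<And>y. y \<in> V \<Longrightarrow> g' y = inv (blinfun_apply (f' (g y)))"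
    and bij: "\<And>y. y \<in> V \<Longrightarrow> bij (blinfun_apply (f' (g y)))"
    by (rule inverse_function_theorem[OF \<open>open U1\<close> derf contf \<open>0 \<in> U1\<close> invf], assumption, rule that)
  have gU: "g y \<in> U'" and fg: "f (g y) = y" if "y \<in> V" for y
    using hom that by (auto simp: homeomorphism_def)
  have gV: "g y \<in> U" "B (g y) \<noteq> 0" if "y \<in> V" for y
    using gU[OF that] U'(2) by (auto simp: U1_def)
  have g'_eq: "g' y v = (fst v, (snd v - fst v * A (g y)) * inverse (B (g y)))" if "y \<in> V" for y v
  proof -
    have "D (g y) (g' y v) = v"
      using bij[OF that] g'[OF that] by (simp add: f'app bij_is_surj surj_f_inv_f)
    then have "fst (D (g y) (g' y v)) = fst v" "snd (D (g y) (g' y v)) = snd v"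
      by simp_all
    then have "fst (g' y v) = fst v" and "snd (g' y v) * B (g y) = snd v - fst v * A (g y)"
      by (simp_all add: D_def)
    then show ?thesis
      using gV(2)[OF that] by (simp add: prod_eq_iff field_simps)
  qed
  \<comment> \<open>Each round of the induction gains one order of differentiability from \<open>g'_eq\<close>. The difference
    is written as a sum with \<open>(- fst v)\<close>, a constant for fixed \<open>v\<close>, to fit the sum and product rules.\<close>
  have "k_differentiable_on k V g" for k
  proof (induction k)
    case 0
    then show ?case using hom by (simp add: homeomorphism_def)
  next
    case (Suc k)
    have AB: "k_differentiable_on k V (\<lambda>y. A (g y))" "k_differentiable_on k V (\<lambda>y. B (g y))"
      using smA smB gV(1) by (auto simp: smooth_on_def intro!: k_differentiable_on_compose[OF V(1) _ Suc])
    show ?case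
    proof (rule k_differentiable_on_SucI[OF V(1)])
      fix y assume y: "y \<in> V"
      have "g' y = (\<lambda>v. (fst v, (snd v + (- fst v) * A (g y)) * inverse (B (g y))))"
        using g'_eq[OF y] by auto
      then show "(g has_derivative (\<lambda>v. (fst v, (snd v + (- fst v) * A (g y)) * inverse (B (g y))))) (at y)"
        using derg[OF y] by simp
    next
      fix v :: "real \<times> real"
      show "k_differentiable_on k V (\<lambda>y. (fst v, (snd v + (- fst v) * A (g y)) * inverse (B (g y))))"
        by (intro k_differentiable_on_Pair[OF V(1)] k_differentiable_on_const
            k_differentiable_on_bilinear[OF V(1) bounded_bilinear_mult]
            k_differentiable_on_add[OF V(1)] AB k_differentiable_on_inverse[OF V(1)] gV)
    qed
  qed
  then have smg: "smooth_on V g" by (simp add: smooth_on_def)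
  have fstg: "fst (g y) = fst y" and rg: "\<rho> (g y) = snd y" if "y \<in> V" for y
    using fg[OF that] by (auto simp: f_def prod_eq_iff)
  show ?thesis
  proof (rule that[of U' V "\<lambda>y. snd (g y)"])
    show "open U'" "0 \<in> U'" "open V" by fact+
    show "U' \<subseteq> U" using U'(2) by (auto simp: U1_def)
    show "0 \<in> V" using V(2) assms(4) by (simp add: f_def zero_prod_def)
    show "smooth_on V (\<lambda>y. snd (g y))"
      by (rule smooth_on_compose[OF V(1) smooth_on_linear[OF open_UNIV bounded_linear_snd] smg]) simp
    fix u Z assume "(u, Z) \<in> U'"
    then have "f (u, Z) \<in> V" "g (f (u, Z)) = (u, Z)"
      using hom by (auto simp: homeomorphism_def)
    then show "(u, \<rho> (u, Z)) \<in> V \<and> snd (g (u, \<rho> (u, Z))) = Z"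
      by (simp add: f_def)
  next
    fix u W assume uW: "(u, W) \<in> V"
    then have "g (u, W) = (u, snd (g (u, W)))"
      using fstg by (simp add: prod_eq_iff)
    then show "(u, snd (g (u, W))) \<in> U' \<and> \<rho> (u, snd (g (u, W))) = W"
      using gU[OF uW] rg[OF uW] by simp
  qed
qed

section \<open>Fibre-preserving maps\<close>

text \<open>The fibres are the lines in direction \<open>e\<close>, with coordinate \<open>L\<close> along them; \<open>q\<close> is constant on
  each fibre. The plane, with \<open>q = X\<^sup>2\<close>, and space, with \<open>q = X\<^sup>2 + Y\<^sup>2\<close>, are the two instances of
  interest, and the common setting makes it possible to treat \<open>\<psi>\<close> and \<open>\<Psi>\<close> at once.\<close>

locale fibration =
  fixes L q :: "'a::euclidean_space \<Rightarrow> real" and e :: 'a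
  assumes L: "bounded_linear L" and L_e: "L e = 1"
    and q: "smooth_on UNIV q" and q_0: "q 0 = 0"
    and q_fibre: "\<And>p s. q (p + s *\<^sub>R e) = q p"
begin

text \<open>The map that keeps each fibre and changes the coordinate \<open>L\<close> on it to \<open>\<rho>(q, L)\<close>.\<close>

definition fibre_map :: "(real \<times> real \<Rightarrow> real) \<Rightarrow> 'a \<Rightarrow> 'a" where
  "fibre_map \<rho> p = p + (\<rho> (q p, L p) - L p) *\<^sub>R e"

lemma L_fibre: "L (p + s *\<^sub>R e) = L p + s"
  using L L_e by (simp add: linear_simps)

lemma L_fibre_map: "L (fibre_map \<rho> p) = \<rho> (q p, L p)"
  by (simp add: fibre_map_def L_fibre)

lemma q_fibre_map: "q (fibre_map \<rho> p) = q p"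
  by (simp add: fibre_map_def q_fibre)

lemma fibre_map_inverse:
  "\<sigma> (q p, \<rho> (q p, L p)) = L p \<Longrightarrow> fibre_map \<sigma> (fibre_map \<rho> p) = p"
  unfolding fibre_map_def[of \<sigma>] by (simp add: L_fibre_map q_fibre_map)
    (simp add: fibre_map_def scaleR_diff_left)

lemma smooth_on_base: "smooth_on UNIV (\<lambda>p. (q p, L p))"
  by (intro smooth_on_Pair q smooth_on_linear L open_UNIV)

lemma open_base_preimage:
  assumes "open U"
  shows "open {p. (q p, L p) \<in> U}"
  using open_vimage[OF assms smooth_on_imp_continuous_on[OF smooth_on_base]]
  by (simp add: vimage_def)

lemma smooth_on_fibre_map:
  assumes "open U" "smooth_on U \<rho>"
  shows "smooth_on {p. (q p, L p) \<in> U} (fibre_map \<rho>)"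
proof -
  let ?S = "{p. (q p, L p) \<in> U}"
  note op = open_base_preimage[OF assms(1)]
  have base: "smooth_on ?S (\<lambda>p. (q p, L p))"
    by (rule smooth_on_subset[OF smooth_on_base]) simp
  have "smooth_on ?S (\<lambda>p. p + (\<rho> (q p, L p) + - L p) *\<^sub>R e)"
    by (intro smooth_on_add[OF op] smooth_on_bilinear[OF op bounded_bilinear_scaleR] smooth_on_const
        smooth_on_linear[OF op] bounded_linear_ident bounded_linear_minus L
        smooth_on_compose[OF op assms(2) base]) auto
  then show ?thesis by (simp add: fibre_map_def[abs_def])
qed

text \<open>A fibre map preserves \<open>q\<close>, hence the fibrewise inverse \<open>\<sigma>\<close> of \<open>\<rho>\<close> yields its inverse. The
  neighbourhoods are the preimages of those on which \<open>\<rho>\<close> and \<open>\<sigma>\<close> are inverse to each other.\<close>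

lemma fibre_map_diffeo:
  assumes "smooth_germ UNIV 0 UNIV 0 \<rho>" and nz: "frechet_derivative \<rho> (at 0) (0, 1) \<noteq> 0"
  shows "diffeo_germ UNIV 0 UNIV 0 (fibre_map \<rho>)"
proof -
  obtain U where U: "open U" "0 \<in> U" "smooth_on U \<rho>" and r0: "\<rho> 0 = 0"
    using assms(1) by (auto simp: smooth_germ_def)
  obtain U' V \<sigma> where U': "open U'" "0 \<in> U'" "U' \<subseteq> U" and V: "open V" "0 \<in> V" "smooth_on V \<sigma>"
    and r: "\<And>u Z. (u, Z) \<in> U' \<Longrightarrow> (u, \<rho> (u, Z)) \<in> V \<and> \<sigma> (u, \<rho> (u, Z)) = Z"
    and s: "\<And>u W. (u, W) \<in> V \<Longrightarrow> (u, \<sigma> (u, W)) \<in> U' \<and> \<rho> (u, \<sigma> (u, W)) = W"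
    using fibrewise_local_inverse[OF U r0 nz] by metis
  let ?P = "{p. (q p, L p) \<in> U'}" and ?Q = "{p. (q p, L p) \<in> V}"
  have smf: "smooth_on ?P (fibre_map \<rho>)"
    by (rule smooth_on_fibre_map[OF U'(1) smooth_on_subset[OF U(3) U'(3)]])
  have smg: "smooth_on ?Q (fibre_map \<sigma>)"
    by (rule smooth_on_fibre_map[OF V(1,3)])
  have 0: "(q 0, L 0) = 0" using q_0 L by (simp add: linear_simps zero_prod_def)
  have "homeomorphism ?P ?Q (fibre_map \<rho>) (fibre_map \<sigma>)"
    using smf smg r s
    by (intro homeomorphismI) (auto simp: smooth_on_imp_continuous_on q_fibre_map L_fibre_map fibre_map_inverse)
  moreover have "fibre_map \<rho> 0 = 0"
    using 0 r0 by (simp add: fibre_map_def zero_prod_def)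
  moreover have "open ?P" "open ?Q" "0 \<in> ?P" "0 \<in> ?Q"
    using open_base_preimage U' V 0 by auto
  ultimately show ?thesis
    using smf smg unfolding diffeo_germ_def by blast
qed

text \<open>Let \<open>G\<close> be the inverse of \<open>F\<close>. On the fibre through the origin,
  \<open>L (G (\<rho>(0, s) e)) = s\<close> for small \<open>s\<close>. If \<open>\<rho>\<^sub>Z(0, 0)\<close> vanished, then by the chain rule so would the
  derivative of the left-hand side at \<open>s = 0\<close>, whereas the derivative of the right-hand side
  is \<open>1\<close>.\<close>

lemma fibre_map_diffeo_imp_derivative_nonzero:
  assumes "smooth_germ UNIV 0 UNIV 0 \<rho>" "diffeo_germ UNIV 0 UNIV 0 F"
    and eq: "germ_eq 0 F (fibre_map \<rho>)"
  shows "frechet_derivative \<rho> (at 0) (0, 1) \<noteq> 0"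
proof
  assume z: "frechet_derivative \<rho> (at 0) (0, 1) = 0"
  obtain U where U: "open U" "0 \<in> U" "smooth_on U \<rho>" and r0: "\<rho> 0 = 0"
    using assms(1) by (auto simp: smooth_germ_def)
  obtain P Q G where P: "open P" "0 \<in> P" and Q: "0 \<in> Q"
    and hom: "homeomorphism P Q F G" and G: "smooth_on Q G"
    using assms(2) by (auto simp: diffeo_germ_def)
  have L0: "L 0 = 0" and Ls: "L (s *\<^sub>R e) = s" and qs: "q (s *\<^sub>R e) = 0" for s
    using L L_e q_0 q_fibre[of 0 s] by (simp_all add: linear_simps)
  have F_line: "fibre_map \<rho> (s *\<^sub>R e) = \<rho> (0, s) *\<^sub>R e" for s
    by (simp add: fibre_map_def Ls qs scaleR_diff_left)
  have "((\<lambda>s. s *\<^sub>R e) \<longlongrightarrow> 0) (nhds (0::real))"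
    by (rule tendsto_eq_intros filterlim_ident refl)+ simp
  moreover have "\<forall>\<^sub>F p in nhds 0. p \<in> P \<and> F p = fibre_map \<rho> p"
    using eq P by (auto simp: germ_eq_def eventually_nhds_in_open intro: eventually_conj)
  ultimately have "\<forall>\<^sub>F s in nhds 0. s *\<^sub>R e \<in> P \<and> F (s *\<^sub>R e) = fibre_map \<rho> (s *\<^sub>R e)"
    by (rule eventually_compose_filterlim[rotated])
  then have ev: "\<forall>\<^sub>F s in nhds 0. L (G (\<rho> (0, s) *\<^sub>R e)) = s"
  proof eventually_elim
    case (elim s)
    then have "G (F (s *\<^sub>R e)) = s *\<^sub>R e" using hom by (auto simp: homeomorphism_def)
    then show ?case using elim F_line Ls by metis
  qed
  have dr: "(\<rho> has_derivative frechet_derivative \<rho> (at 0)) (at (0, 0))"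
    using smooth_on_has_derivative[OF U(3,2)] by (simp add: zero_prod_def)
  have dp: "((\<lambda>s::real. (0::real, s)) has_derivative (\<lambda>h. (0, h))) (at 0)"
    by (auto intro!: derivative_eq_intros)
  have lin: "linear (frechet_derivative \<rho> (at 0))"
    using dr has_derivative_linear by blast
  have "frechet_derivative \<rho> (at 0) (0, h) = 0" for h
    using linear_cmul[OF lin, of h "(0, 1)"] z by simp
  then have "((\<lambda>s. \<rho> (0, s)) has_derivative (\<lambda>h. 0)) (at 0)"
    using has_derivative_compose[OF dp dr] by simp
  then have "((\<lambda>s. \<rho> (0, s) *\<^sub>R e) has_derivative (\<lambda>h. 0)) (at 0)"
    using has_derivative_scaleR_left by fastforce
  moreover have dG: "(G has_derivative frechet_derivative G (at 0)) (at 0)"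
    by (rule smooth_on_has_derivative[OF G Q])
  then have "(G has_derivative frechet_derivative G (at 0)) (at (\<rho> (0, 0) *\<^sub>R e))"
    using r0 by (simp add: zero_prod_def)
  ultimately have "((\<lambda>s. G (\<rho> (0, s) *\<^sub>R e)) has_derivative (\<lambda>h. frechet_derivative G (at 0) 0)) (at 0)"
    by (rule has_derivative_compose)
  then have "((\<lambda>s. L (G (\<rho> (0, s) *\<^sub>R e))) has_derivative (\<lambda>h. L (frechet_derivative G (at 0) 0))) (at 0)"
    by (rule bounded_linear.has_derivative[OF L])
  moreover have "L (frechet_derivative G (at 0) 0) = 0"
    using linear_0[OF has_derivative_linear[OF dG]] L0 by simp
  ultimately have retract: "((\<lambda>s. L (G (\<rho> (0, s) *\<^sub>R e))) has_derivative (\<lambda>h. 0)) (at 0)"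
    by simp
  have "((\<lambda>s::real. s) has_derivative (\<lambda>h. 0)) (at 0)"
    by (rule has_derivative_transform_eventually[OF retract])
      (use ev in \<open>auto dest: eventually_nhds_x_imp_x simp: eventually_at_filter elim: eventually_mono\<close>)
  from has_derivative_unique[OF this has_derivative_ident]
  have "(0::real) = 1" by (rule fun_cong)
  then show False by simp
qed

end

lemma smooth_on_square: "smooth_on UNIV (\<lambda>x. (h x)\<^sup>2)"
  if "bounded_linear h" for h :: "'a::euclidean_space \<Rightarrow> real"
  unfolding power2_eq_square
  by (rule smooth_on_bilinear[OF open_UNIV bounded_bilinear_mult];
      rule smooth_on_linear[OF open_UNIV that])

interpretation plane: fibration snd "\<lambda>p. (fst p)\<^sup>2" "(0::real, 1)"
  by (rule fibration.intro)
    (simp_all add: bounded_linear_snd smooth_on_square[OF bounded_linear_fst])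

interpretation axial: fibration "\<lambda>p. snd (snd p)" "\<lambda>p. (fst p)\<^sup>2 + (fst (snd p))\<^sup>2"
  "(0::real, 0::real, 1)"
proof (rule fibration.intro)
  show "bounded_linear (\<lambda>p::real \<times> real \<times> real. snd (snd p))"
    by (rule bounded_linear_snd_comp[OF bounded_linear_snd])
  show "smooth_on UNIV (\<lambda>p::real \<times> real \<times> real. (fst p)\<^sup>2 + (fst (snd p))\<^sup>2)"
    by (rule smooth_on_add[OF open_UNIV smooth_on_square[OF bounded_linear_fst]
          smooth_on_square[OF bounded_linear_fst_comp[OF bounded_linear_snd]]])
qed simp_all

lemma plane_fibre_map: "plane.fibre_map \<rho> = (\<lambda>(X, Z). (X, \<rho> (X\<^sup>2, Z)))"
  by (auto simp: plane.fibre_map_def fun_eq_iff)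

lemma axial_fibre_map: "axial.fibre_map \<rho> = (\<lambda>(X, Y, Z). (X, Y, \<rho> (X\<^sup>2 + Y\<^sup>2, Z)))"
  by (auto simp: axial.fibre_map_def fun_eq_iff)

section \<open>Curves and their surfaces of revolution\<close>

lemma diffeo_germ_times_id:
  assumes "diffeo_germ S a T b f"
  shows "diffeo_germ (S \<times> UNIV) (a, c::'c::euclidean_space) (T \<times> UNIV) (b, c) (\<lambda>(t, \<theta>). (f t, \<theta>))"
proof -
  obtain U V g where U: "open U" "a \<in> U" "U \<subseteq> S" and V: "open V" "b \<in> V" "V \<subseteq> T"
    and hom: "homeomorphism U V f g" and sm: "smooth_on U f" "smooth_on V g" and fa: "f a = b"
    using assms unfolding diffeo_germ_def by blast
  have sm_times: "smooth_on (W \<times> UNIV) (\<lambda>(t, \<theta>::'c). (h t, \<theta>))"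
    if "open W" "smooth_on W h" for W and h :: "'d::euclidean_space \<Rightarrow> 'e::euclidean_space"
  proof -
    have op: "open (W \<times> (UNIV::'c set))" using that by (simp add: open_Times)
    show ?thesis unfolding case_prod_beta
      by (intro smooth_on_Pair[OF op] smooth_on_compose[OF op that(2)] smooth_on_linear[OF op]
          bounded_linear_fst bounded_linear_snd) auto
  qed
  note smf = sm_times[OF U(1) sm(1)] and smg = sm_times[OF V(1) sm(2)]
  have "homeomorphism (U \<times> UNIV) (V \<times> UNIV) (\<lambda>(t, \<theta>::'c). (f t, \<theta>)) (\<lambda>(t, \<theta>). (g t, \<theta>))"
    using smooth_on_imp_continuous_on[OF smf] smooth_on_imp_continuous_on[OF smg] hom
    by (intro homeomorphismI) (auto simp: homeomorphism_def)
  then show ?thesis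
    using U V smf smg fa unfolding diffeo_germ_def
    by (intro conjI exI[of _ "U \<times> UNIV"] exI[of _ "V \<times> UNIV"] exI[of _ "\<lambda>(t, \<theta>). (g t, \<theta>)"])
      (auto simp: open_Times)
qed

lemma smooth_germ_tendsto:
  assumes "smooth_germ S a T b f"
  shows "(f \<longlongrightarrow> b) (nhds a)"
proof -
  obtain U where "open U" "a \<in> U" "smooth_on U f" and "f a = b"
    using assms by (auto simp: smooth_germ_def)
  then have "isCont f a"
    using smooth_on_imp_continuous_on continuous_on_eq_continuous_at by blast
  then have "(f \<longlongrightarrow> f a) (nhds a)"
    by (simp add: continuous_at tendsto_at_iff_tendsto_nhds)
  then show ?thesis
    using \<open>f a = b\<close> by simp
qed

text \<open>For the direction from left to right, the first two components say that \<open>x\<close> and the first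
  coordinate of \<open>\<gamma>' t'\<close> agree after multiplication by \<open>cos \<theta>\<close> and by \<open>sin \<theta>\<close>, one of which is not
  zero.\<close>

lemma surface_of_revolution_commutes_iff:
  "(case surface_of_revolution \<gamma> (t, \<theta>) of (X, Y, Z) \<Rightarrow> (X, Y, \<rho> (X\<^sup>2 + Y\<^sup>2, Z)))
      = surface_of_revolution \<gamma>' (t', \<theta>)
    \<longleftrightarrow> (case \<gamma> t of (X, Z) \<Rightarrow> (X, \<rho> (X\<^sup>2, Z))) = \<gamma>' t'"
proof -
  have sq: "(x * cos \<theta>)\<^sup>2 + (x * sin \<theta>)\<^sup>2 = x\<^sup>2" for x
    by (simp add: power_mult_distrib flip: distrib_left)
  have "cos \<theta> \<noteq> 0 \<or> sin \<theta> \<noteq> 0"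
    using sin_cos_squared_add[of \<theta>] by (auto simp: power2_eq_square)
  then show ?thesis
    by (cases "\<gamma> t"; cases "\<gamma>' t'") (auto simp: surface_of_revolution_def sq)
qed

theorem theorem3p23:
  fixes I I' :: "real set" and t\<^sub>0 t\<^sub>0' \<theta>\<^sub>0 :: real
    and \<gamma> \<gamma>' :: "real \<Rightarrow> real \<times> real"
    and z z' :: "real \<times> real \<Rightarrow> real \<times> real \<times> real"
  assumes "open I" and "is_interval I" and "t\<^sub>0 \<in> I"
    and "open I'" and "is_interval I'" and "t\<^sub>0' \<in> I'"
    and "smooth_germ I t\<^sub>0 UNIV 0 \<gamma>"
    and "smooth_germ I' t\<^sub>0' UNIV 0 \<gamma>'"
    and "\<theta>\<^sub>0 \<in> {0..<2 * pi}"
    and "z = surface_of_revolution \<gamma>"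
    and "z' = surface_of_revolution \<gamma>'"
  shows "(\<forall>(\<phi> :: real \<Rightarrow> real) (\<psi> :: real \<times> real \<Rightarrow> real \<times> real) (\<rho> :: real \<times> real \<Rightarrow> real).
      smooth_germ UNIV 0 UNIV 0 \<rho> \<and>
      diffeo_germ I t\<^sub>0 I' t\<^sub>0' \<phi> \<and>
      diffeo_germ UNIV 0 UNIV 0 \<psi> \<and>
      germ_eq 0 \<psi> (\<lambda>(X, Z). (X, \<rho> (X\<^sup>2, Z))) \<and>
      germ_eq t\<^sub>0 (\<psi> \<circ> \<gamma>) (\<gamma>' \<circ> \<phi>) \<longrightarrow>
      (\<exists>(\<Phi> :: real \<times> real \<Rightarrow> real \<times> real) (\<Psi> :: real \<times> real \<times> real \<Rightarrow> real \<times> real \<times> real).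
        diffeo_germ (I \<times> UNIV) (t\<^sub>0, \<theta>\<^sub>0) (I' \<times> UNIV) (t\<^sub>0', \<theta>\<^sub>0) \<Phi> \<and>
        germ_eq (t\<^sub>0, \<theta>\<^sub>0) \<Phi> (\<lambda>(t, \<theta>). (\<phi> t, \<theta>)) \<and>
        diffeo_germ UNIV 0 UNIV 0 \<Psi> \<and>
        germ_eq 0 \<Psi> (\<lambda>(X, Y, Z). (X, Y, \<rho> (X\<^sup>2 + Y\<^sup>2, Z))) \<and>
        germ_eq (t\<^sub>0, \<theta>\<^sub>0) (\<Psi> \<circ> z) (z' \<circ> \<Phi>)))
    \<and>
    (\<forall>(\<phi> :: real \<Rightarrow> real) (\<rho> :: real \<times> real \<Rightarrow> real)
      (\<Phi> :: real \<times> real \<Rightarrow> real \<times> real) (\<Psi> :: real \<times> real \<times> real \<Rightarrow> real \<times> real \<times> real).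
      smooth_germ UNIV 0 UNIV 0 \<rho> \<and>
      diffeo_germ (I \<times> UNIV) (t\<^sub>0, \<theta>\<^sub>0) (I' \<times> UNIV) (t\<^sub>0', \<theta>\<^sub>0) \<Phi> \<and>
      germ_eq (t\<^sub>0, \<theta>\<^sub>0) \<Phi> (\<lambda>(t, \<theta>). (\<phi> t, \<theta>)) \<and>
      diffeo_germ UNIV 0 UNIV 0 \<Psi> \<and>
      germ_eq 0 \<Psi> (\<lambda>(X, Y, Z). (X, Y, \<rho> (X\<^sup>2 + Y\<^sup>2, Z))) \<and>
      germ_eq (t\<^sub>0, \<theta>\<^sub>0) (\<Psi> \<circ> z) (z' \<circ> \<Phi>) \<longrightarrow>
      (\<exists>\<psi> :: real \<times> real \<Rightarrow> real \<times> real.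
        diffeo_germ UNIV 0 UNIV 0 \<psi> \<and>
        germ_eq 0 \<psi> (\<lambda>(X, Z). (X, \<rho> (X\<^sup>2, Z))) \<and>
        germ_eq t\<^sub>0 (\<psi> \<circ> \<gamma>) (\<gamma>' \<circ> \<phi>)))"
proof -
  note curve = smooth_germ_tendsto[OF \<open>smooth_germ I t\<^sub>0 UNIV 0 \<gamma>\<close>]
  have first: "(fst \<longlongrightarrow> t\<^sub>0) (nhds (t\<^sub>0, \<theta>\<^sub>0))"
    using tendsto_fst[OF filterlim_ident] by fastforce
  have "((\<lambda>p. (fst (\<gamma> (fst p)) * cos (snd p), fst (\<gamma> (fst p)) * sin (snd p), snd (\<gamma> (fst p))))
      \<longlongrightarrow> (0 * cos \<theta>\<^sub>0, 0 * sin \<theta>\<^sub>0, 0)) (nhds (t\<^sub>0, \<theta>\<^sub>0))"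
  proof -
    have snd0: "(snd \<longlongrightarrow> \<theta>\<^sub>0) (nhds (t\<^sub>0, \<theta>\<^sub>0))"
      using tendsto_snd[OF filterlim_ident] by fastforce
    have g0: "((\<lambda>p. \<gamma> (fst p)) \<longlongrightarrow> 0) (nhds (t\<^sub>0, \<theta>\<^sub>0))"
      by (rule filterlim_compose[OF curve first])
    show ?thesis
      using tendsto_fst[OF g0] tendsto_snd[OF g0]
      by (intro tendsto_Pair tendsto_mult tendsto_cos tendsto_sin snd0) simp_all
  qed
  then have surface: "(z \<longlongrightarrow> 0) (nhds (t\<^sub>0, \<theta>\<^sub>0))"
    unfolding \<open>z = _\<close> surface_of_revolution_def case_prod_beta by (simp add: zero_prod_def)
  have slice: "((\<lambda>t. (t, \<theta>\<^sub>0)) \<longlongrightarrow> (t\<^sub>0, \<theta>\<^sub>0)) (nhds t\<^sub>0)"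
    by (intro tendsto_Pair filterlim_ident tendsto_const)
  show ?thesis
  proof (intro conjI allI impI; elim conjE)
    fix \<phi> :: "real \<Rightarrow> real" and \<psi> :: "real \<times> real \<Rightarrow> real \<times> real" and \<rho> :: "real \<times> real \<Rightarrow> real"
    assume \<rho>: "smooth_germ UNIV 0 UNIV 0 \<rho>" and \<phi>: "diffeo_germ I t\<^sub>0 I' t\<^sub>0' \<phi>"
      and \<psi>: "diffeo_germ UNIV 0 UNIV 0 \<psi>" "germ_eq 0 \<psi> (\<lambda>(X, Z). (X, \<rho> (X\<^sup>2, Z)))"
      and comm: "germ_eq t\<^sub>0 (\<psi> \<circ> \<gamma>) (\<gamma>' \<circ> \<phi>)"
    let ?\<Phi> = "\<lambda>(t, \<theta>). (\<phi> t, \<theta>::real)"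
    let ?\<Psi> = "\<lambda>(X, Y, Z). (X, Y, \<rho> (X\<^sup>2 + Y\<^sup>2, Z))"
    have "diffeo_germ UNIV 0 UNIV 0 ?\<Psi>"
      using axial.fibre_map_diffeo[OF \<rho>] plane.fibre_map_diffeo_imp_derivative_nonzero[OF \<rho> \<psi>(1)] \<psi>(2)
      by (simp add: plane_fibre_map axial_fibre_map)
    moreover have "diffeo_germ (I \<times> UNIV) (t\<^sub>0, \<theta>\<^sub>0) (I' \<times> UNIV) (t\<^sub>0', \<theta>\<^sub>0) ?\<Phi>"
      by (rule diffeo_germ_times_id[OF \<phi>])
    moreover have "germ_eq (t\<^sub>0, \<theta>\<^sub>0) (?\<Psi> \<circ> z) (z' \<circ> ?\<Phi>)"
    proof -
      have "\<forall>\<^sub>F t in nhds t\<^sub>0. \<psi> (\<gamma> t) = (case \<gamma> t of (X, Z) \<Rightarrow> (X, \<rho> (X\<^sup>2, Z)))"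
        using eventually_compose_filterlim[OF \<psi>(2)[unfolded germ_eq_def] curve] .
      moreover have "\<forall>\<^sub>F t in nhds t\<^sub>0. \<psi> (\<gamma> t) = \<gamma>' (\<phi> t)"
        using comm by (simp add: germ_eq_def)
      ultimately have "\<forall>\<^sub>F t in nhds t\<^sub>0. (case \<gamma> t of (X, Z) \<Rightarrow> (X, \<rho> (X\<^sup>2, Z))) = \<gamma>' (\<phi> t)"
        by eventually_elim simp
      from eventually_compose_filterlim[OF this first]
      show ?thesis
        unfolding germ_eq_def
      proof eventually_elim
        case (elim p)
        then show ?case
          using surface_of_revolution_commutes_iff[of \<rho> \<gamma> "fst p" "snd p" \<gamma>' "\<phi> (fst p)"] \<open>z = _\<close> \<open>z' = _\<close>
          by (simp add: case_prod_beta)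
      qed
    qed
    ultimately show "\<exists>\<Phi> \<Psi>.
        diffeo_germ (I \<times> UNIV) (t\<^sub>0, \<theta>\<^sub>0) (I' \<times> UNIV) (t\<^sub>0', \<theta>\<^sub>0) \<Phi> \<and>
        germ_eq (t\<^sub>0, \<theta>\<^sub>0) \<Phi> (\<lambda>(t, \<theta>). (\<phi> t, \<theta>)) \<and>
        diffeo_germ UNIV 0 UNIV 0 \<Psi> \<and>
        germ_eq 0 \<Psi> (\<lambda>(X, Y, Z). (X, Y, \<rho> (X\<^sup>2 + Y\<^sup>2, Z))) \<and>
        germ_eq (t\<^sub>0, \<theta>\<^sub>0) (\<Psi> \<circ> z) (z' \<circ> \<Phi>)"
      by (intro exI[of _ ?\<Phi>] exI[of _ ?\<Psi>]) (simp add: germ_eq_def)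
  next
    fix \<phi> :: "real \<Rightarrow> real" and \<rho> :: "real \<times> real \<Rightarrow> real"
      and \<Phi> :: "real \<times> real \<Rightarrow> real \<times> real" and \<Psi> :: "real \<times> real \<times> real \<Rightarrow> real \<times> real \<times> real"
    assume \<rho>: "smooth_germ UNIV 0 UNIV 0 \<rho>"
      and \<Phi>: "germ_eq (t\<^sub>0, \<theta>\<^sub>0) \<Phi> (\<lambda>(t, \<theta>). (\<phi> t, \<theta>))"
      and \<Psi>: "diffeo_germ UNIV 0 UNIV 0 \<Psi>"
        "germ_eq 0 \<Psi> (\<lambda>(X, Y, Z). (X, Y, \<rho> (X\<^sup>2 + Y\<^sup>2, Z)))"
      and comm: "germ_eq (t\<^sub>0, \<theta>\<^sub>0) (\<Psi> \<circ> z) (z' \<circ> \<Phi>)"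
    let ?\<psi> = "\<lambda>(X, Z). (X, \<rho> (X\<^sup>2, Z))"
    have "diffeo_germ UNIV 0 UNIV 0 ?\<psi>"
      using plane.fibre_map_diffeo[OF \<rho>] axial.fibre_map_diffeo_imp_derivative_nonzero[OF \<rho> \<Psi>(1)] \<Psi>(2)
      by (simp add: plane_fibre_map axial_fibre_map)
    moreover have "germ_eq t\<^sub>0 (?\<psi> \<circ> \<gamma>) (\<gamma>' \<circ> \<phi>)"
    proof -
      have "\<forall>\<^sub>F p in nhds (t\<^sub>0, \<theta>\<^sub>0). \<Psi> (z p) = (case z p of (X, Y, Z) \<Rightarrow> (X, Y, \<rho> (X\<^sup>2 + Y\<^sup>2, Z)))"
        using eventually_compose_filterlim[OF \<Psi>(2)[unfolded germ_eq_def] surface] .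
      moreover have "\<forall>\<^sub>F p in nhds (t\<^sub>0, \<theta>\<^sub>0). \<Psi> (z p) = z' (\<Phi> p)"
        using comm by (simp add: germ_eq_def)
      ultimately have "\<forall>\<^sub>F p in nhds (t\<^sub>0, \<theta>\<^sub>0).
          (case z p of (X, Y, Z) \<Rightarrow> (X, Y, \<rho> (X\<^sup>2 + Y\<^sup>2, Z))) = z' (\<phi> (fst p), snd p)"
        using \<Phi>[unfolded germ_eq_def] by eventually_elim (simp add: case_prod_beta)
      from eventually_compose_filterlim[OF this slice]
      show ?thesis
        unfolding germ_eq_def
      proof eventually_elim
        case (elim t)
        then show ?case
          using surface_of_revolution_commutes_iff[of \<rho> \<gamma> t \<theta>\<^sub>0 \<gamma>' "\<phi> t"] \<open>z = _\<close> \<open>z' = _\<close> by simp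
      qed
    qed
    ultimately show "\<exists>\<psi>. diffeo_germ UNIV 0 UNIV 0 \<psi> \<and>
        germ_eq 0 \<psi> (\<lambda>(X, Z). (X, \<rho> (X\<^sup>2, Z))) \<and> germ_eq t\<^sub>0 (\<psi> \<circ> \<gamma>) (\<gamma>' \<circ> \<phi>)"
      by (intro exI[of _ ?\<psi>]) (simp add: germ_eq_def)
  qed
qed

end
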